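(* Let $T$ be a linear operator associated with a compact Calderón–Zygmund kernel $K$ on $\mathbb R^n$ with parameter $0<\delta<1$ and auxiliary functions $L,S,D$. Let $f$ be an integrable function supported on a cube $I$. Then $$ |T(f)(x)|\lesssim w_I(x)^{-n}\,F_K(\langle I,x\rangle)\,|I|^{-1}\|f\|_{L^1(I)} $$ for all $x\in\mathbb R^n$ such that $x\notin 5I$. Moreover, $$ |T(f)(x)-T(f)(x')|\lesssim \frac{|x-x'|_\infty^{\delta}}{\ell(I)^{\delta}}\,w_I\Big(\frac{x+x'}{2}\Big)^{-(n+\delta)} L(\ell(\langle I,x\rangle))\,S(|x-x'|_\infty)\,D(\mathrm{rdist}(\langle I,x\rangle,\mathbb B))\,|I|^{-1}\|f\|_{L^1(I)} $$ for all $x,x'\in\mathbb R^n$ such that $|x-x'|_\infty<\ell(I)/2$ and $\langle x,x'\rangle\cap 5I=\emptyset$. The implicit constants are independent of $f$, $I$, $x$ and $x'$.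
   Context: **Cubes.** A cube is $I=\prod_{i=1}^n[a_i,b_i]$ with all $b_i-a_i>0$ equal; $c(I)$ is its centre, $\ell(I)$ its side length, $|I|=\ell(I)^n$; $\lambda I$ is the cube with the same centre and side $\lambda\ell(I)$. $|\cdot|_\infty$ is the max norm on $\mathbb R^n$, $\mathbb B=[-1/2,1/2]^n$. $\langle I,J\rangle$ is the cube containing $I\cup J$ with smallest possible side length and whose centre has smallest possible first coordinate (any fixed choice if this is not unique); the notation is also used with points, regarded as degenerate cubes ($\langle I,x\rangle$, $\langle x,x'\rangle$). Put $\mathrm{rdist}(I,J)=\ell(\langle I,J\rangle)/\max(\ell(I),\ell(J))$ and $w_I(x)=1+\ell(I)^{-1}|x-c(I)|_\infty$. **Kernel.** $K$ is defined on $\{(t,x)\in\mathbb R^n\times\mathbb R^n: t\ne x\}$ with values in $\mathbb C$. $L,S,D:[0,\infty)\to[0,\infty)$ are bounded, $L,D$ non-increasing, $S$ non-decreasing, with $\lim_{y\to\infty}L(y)=\lim_{y\to0}S(y)=\lim_{y\to\infty}D(y)=0$. That $K$ is a compact Calderón–Zygmund kernel with parameter $\delta$ and functions $L,S,D$ means (this is the working form of the definition): for some constant $C_K>0$, $$|K(t,x)-K(t',x')|\le C_K\frac{(|t-t'|_\infty+|x-x'|_\infty)^{\delta}}{|t-x|_\infty^{n+\delta}}\,L(|t-x|_\infty)\,S(|t-t'|_\infty+|x-x'|_\infty)\,D\Big(1+\frac{|t+x|_\infty}{1+|t-x|_\infty}\Big)$$ whenever $2(|t-t'|_\infty+|x-x'|_\infty)<|t-x|_\infty$,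 and $$|K(t,x)|\le C_K\frac{1}{|t-x|_\infty^{n}}\,L(|t-x|_\infty)\,S(|t-x|_\infty)\,D\Big(1+\frac{|t+x|_\infty}{1+|t-x|_\infty}\Big)\quad (t\neq x).$$ **Function $F_K$.** For a cube $Q$, $F_K(Q)=L(\ell(Q))\,S(\ell(Q))\,D(\mathrm{rdist}(Q,\mathbb B))$. **Convention on constants.** Universal constants inside the arguments of $L,S,D$ are omitted: the estimates are understood to hold after replacing $L,S,D$ on their right-hand sides by $L(\kappa\,\cdot),S(\kappa^{-1}\cdot),D(\kappa\,\cdot)$ for some constant $\kappa\in(0,1]$ depending only on $n$ and $\delta$. **Operator.** $T:\mathcal C_0(\mathbb R^n)\to\mathcal C_0(\mathbb R^n)'$ is continuous and linear ($\mathcal C_0(\mathbb R^n)$: continuous functions with compact support), and is associated with $K$: $\langle T(f),g\rangle=\iint f(t)g(x)K(x,t)\,dt\,dx$ whenever $f,g$ have disjoint compact supports; this formula is also used to define the pairing for $f$ integrable with compact support and $g\in\mathcal C_0(\mathbb R^n)$ with support disjoint from that of $f$. No boundedness, weak compactness or cancellation hypotheses are assumed on $T$. **Pointwise values.** Let $\Phi\in\mathcal S(\mathbb R^n)$ be non-negative, supported on $\mathbb B$, with $\int\Phi=1$, and $\Phi_{x,\epsilon}(y)=\epsilon^{-n}\Phi(\epsilon^{-1}(y-x))$. For $f$ integrable supported in a cube $I$ and $x\notin3I$, $T(f)(x)=\lim_{\epsilon\to0}\langle T(f),\Phi_{x,\epsilon}\rangle$ (the limit exists). *)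

theory Defs
  imports "HOL-Analysis.Analysis"
begin

section \<open>Cubes\<close>

text \<open>A cube in \<open>\<real>\<^sup>n\<close> is stored as its centre and its side length. Genuine cubes have positive side
  length; \<open>Cube x 0\<close> is the degenerate cube \<open>{x}\<close>. The dimension \<open>n\<close> is \<open>CARD('n)\<close>. The order on the
  index type serves only to say which coordinate is the first one. The max norm
  is the library's \<^const>\<open>infnorm\<close>.\<close>

datatype 'a cube = Cube (centre: 'a) (side: real)

definition cube_set :: "(real ^ 'n) cube \<Rightarrow> (real ^ 'n) set" where
  "cube_set Q = cbox (centre Q - vec (side Q / 2)) (centre Q + vec (side Q / 2))"

definition vol :: "(real ^ 'n) cube \<Rightarrow> real" where
  "vol Q = side Q ^ CARD('n)"

definition dilate :: "real \<Rightarrow> (real ^ 'n) cube \<Rightarrow> (real ^ 'n) cube" where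
  "dilate c Q = Cube (centre Q) (c * side Q)"

definition point_cube :: "real ^ 'n \<Rightarrow> (real ^ 'n) cube" where
  "point_cube x = Cube x 0"

definition unit_cube :: "(real ^ 'n) cube" where
  "unit_cube = Cube 0 1"

definition encloses :: "(real ^ 'n) cube \<Rightarrow> (real ^ 'n) cube \<Rightarrow> (real ^ 'n) cube \<Rightarrow> bool" where
  "encloses Q I J \<longleftrightarrow> 0 \<le> side Q \<and> cube_set I \<union> cube_set J \<subseteq> cube_set Q"

definition is_hull_cube ::
  "(real ^ 'n::{finite,linorder}) cube \<Rightarrow> (real ^ 'n::{finite,linorder}) cube \<Rightarrow> (real ^ 'n::{finite,linorder}) cube \<Rightarrow> bool" where
  "is_hull_cube I J Q \<longleftrightarrow>
     encloses Q I J \<and>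
     (\<forall>Q'. encloses Q' I J \<longrightarrow> side Q \<le> side Q') \<and>
     (\<forall>Q'. encloses Q' I J \<and> side Q' = side Q \<longrightarrow>
            centre Q $ Min UNIV \<le> centre Q' $ Min UNIV)"

text \<open>The conditions above determine the side length and the first coordinate of the centre, but
  not the other coordinates; a fixed choice is made.\<close>

definition hull_cube ::
  "(real ^ 'n::{finite,linorder}) cube \<Rightarrow> (real ^ 'n::{finite,linorder}) cube \<Rightarrow> (real ^ 'n::{finite,linorder}) cube" where
  "hull_cube I J = (SOME Q. is_hull_cube I J Q)"

definition rdist :: "(real ^ 'n::{finite,linorder}) cube \<Rightarrow> (real ^ 'n::{finite,linorder}) cube \<Rightarrow> real" where
  "rdist I J = side (hull_cube I J) / max (side I) (side J)"

definition wgt :: "(real ^ 'n) cube \<Rightarrow> real ^ 'n \<Rightarrow> real" where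
  "wgt I x = 1 + infnorm (x - centre I) / side I"


section \<open>Compact Calderon-Zygmund kernels\<close>

text \<open>Functions on \<open>[0,\<infinity>)\<close> are functions on the reals whose values at negative
  arguments are irrelevant.\<close>

definition admissible_LSD :: "(real \<Rightarrow> real) \<Rightarrow> (real \<Rightarrow> real) \<Rightarrow> (real \<Rightarrow> real) \<Rightarrow> bool" where
  "admissible_LSD L S D \<longleftrightarrow>
     (\<forall>y\<ge>0. 0 \<le> L y \<and> 0 \<le> S y \<and> 0 \<le> D y) \<and>
     bounded (L ` {0..}) \<and> bounded (S ` {0..}) \<and> bounded (D ` {0..}) \<and>
     antimono_on {0..} L \<and> mono_on {0..} S \<and> antimono_on {0..} D \<and>
     (L \<longlongrightarrow> 0) at_top \<and> (S \<longlongrightarrow> 0) (at_right 0) \<and> (D \<longlongrightarrow> 0) at_top"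

text \<open>Only the values of \<open>K\<close> off the diagonal matter.\<close>

definition compact_CZ_kernel ::
  "(real ^ 'n \<Rightarrow> real ^ 'n \<Rightarrow> complex) \<Rightarrow> real \<Rightarrow>
   (real \<Rightarrow> real) \<Rightarrow> (real \<Rightarrow> real) \<Rightarrow> (real \<Rightarrow> real) \<Rightarrow> bool" where
  "compact_CZ_kernel K \<delta> L S D \<longleftrightarrow>
     admissible_LSD L S D \<and>
     (\<exists>CK>0.
       (\<forall>t x t' x'. 2 * (infnorm (t - t') + infnorm (x - x')) < infnorm (t - x) \<longrightarrow>
          norm (K t x - K t' x') \<le>
            CK * ((infnorm (t - t') + infnorm (x - x')) powr \<delta>
                   / infnorm (t - x) powr (real CARD('n) + \<delta>))
             * L (infnorm (t - x)) * S (infnorm (t - t') + infnorm (x - x'))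
             * D (1 + infnorm (t + x) / (1 + infnorm (t - x)))) \<and>
       (\<forall>t x. t \<noteq> x \<longrightarrow>
          norm (K t x) \<le>
            CK * (1 / infnorm (t - x) ^ CARD('n))
             * L (infnorm (t - x)) * S (infnorm (t - x))
             * D (1 + infnorm (t + x) / (1 + infnorm (t - x)))))"

definition F_K ::
  "(real \<Rightarrow> real) \<Rightarrow> (real \<Rightarrow> real) \<Rightarrow> (real \<Rightarrow> real) \<Rightarrow>
   (real ^ 'n::{finite,linorder}) cube \<Rightarrow> real" where
  "F_K L S D Q = L (side Q) * S (side Q) * D (rdist Q unit_cube)"


section \<open>Operators on compactly supported continuous functions\<close>

definition supp :: "(real ^ 'n \<Rightarrow> complex) \<Rightarrow> (real ^ 'n) set" where
  "supp f = closure {x. f x \<noteq> 0}"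

definition Cc :: "(real ^ 'n \<Rightarrow> complex) set" where
  "Cc = {f. continuous_on UNIV f \<and> compact (supp f)}"

definition sup_norm :: "(real ^ 'n \<Rightarrow> complex) \<Rightarrow> real" where
  "sup_norm f = (SUP x. norm (f x))"

text \<open>\<^const>\<open>Cc\<close> carries its usual inductive limit topology: a linear functional is continuous iff
  its restriction to the functions supported in any given compact set is bounded for the sup norm.\<close>

definition Cc_dual :: "((real ^ 'n \<Rightarrow> complex) \<Rightarrow> complex) set" where
  "Cc_dual = {u.
     (\<forall>g\<in>Cc. \<forall>h\<in>Cc. u (\<lambda>x. g x + h x) = u g + u h) \<and>
     (\<forall>g\<in>Cc. \<forall>a. u (\<lambda>x. a * g x) = a * u g) \<and>
     (\<forall>B. compact B \<longrightarrow> (\<exists>C. \<forall>g\<in>Cc. supp g \<subseteq> B \<longrightarrow> norm (u g) \<le> C * sup_norm g))}"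

text \<open>\<open>T f g\<close> is the pairing of \<open>T f\<close> with \<open>g\<close>. The last clause is continuity into the dual with its
  strong topology (bounded sets of \<^const>\<open>Cc\<close> are the uniformly bounded sets of functions supported
  in one compact set); by the uniform boundedness principle the weak-* topology gives the
  same operators.\<close>

definition cont_linear_op ::
  "((real ^ 'n \<Rightarrow> complex) \<Rightarrow> (real ^ 'n \<Rightarrow> complex) \<Rightarrow> complex) \<Rightarrow> bool" where
  "cont_linear_op T \<longleftrightarrow>
     (\<forall>f\<in>Cc. T f \<in> Cc_dual) \<and>
     (\<forall>f\<in>Cc. \<forall>h\<in>Cc. \<forall>g\<in>Cc. T (\<lambda>t. f t + h t) g = T f g + T h g) \<and>
     (\<forall>f\<in>Cc. \<forall>a. \<forall>g\<in>Cc. T (\<lambda>t. a * f t) g = a * T f g) \<and>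
     (\<forall>A B. compact A \<and> compact B \<longrightarrow>
        (\<exists>C. \<forall>f\<in>Cc. \<forall>g\<in>Cc. supp f \<subseteq> A \<and> supp g \<subseteq> B \<longrightarrow>
           norm (T f g) \<le> C * sup_norm f * sup_norm g))"

definition kernel_form ::
  "(real ^ 'n \<Rightarrow> real ^ 'n \<Rightarrow> complex) \<Rightarrow>
   (real ^ 'n \<Rightarrow> complex) \<Rightarrow> (real ^ 'n \<Rightarrow> complex) \<Rightarrow> complex" where
  "kernel_form K f g = (LINT x|lebesgue. (LINT t|lebesgue. f t * g x * K x t))"

definition associated ::
  "((real ^ 'n \<Rightarrow> complex) \<Rightarrow> (real ^ 'n \<Rightarrow> complex) \<Rightarrow> complex) \<Rightarrow>
   (real ^ 'n \<Rightarrow> real ^ 'n \<Rightarrow> complex) \<Rightarrow> bool" where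
  "associated T K \<longleftrightarrow>
     (\<forall>f\<in>Cc. \<forall>g\<in>Cc. supp f \<inter> supp g = {} \<longrightarrow> T f g = kernel_form K f g)"

text \<open>The pairing extended beyond \<^const>\<open>Cc\<close>. The second branch is meant for integrable
  compactly supported \<open>f\<close> and \<open>g \<in> Cc\<close> with disjoint supports.\<close>

definition pairing ::
  "((real ^ 'n \<Rightarrow> complex) \<Rightarrow> (real ^ 'n \<Rightarrow> complex) \<Rightarrow> complex) \<Rightarrow>
   (real ^ 'n \<Rightarrow> real ^ 'n \<Rightarrow> complex) \<Rightarrow>
   (real ^ 'n \<Rightarrow> complex) \<Rightarrow> (real ^ 'n \<Rightarrow> complex) \<Rightarrow> complex" where
  "pairing T K f g = (if f \<in> Cc then T f g else kernel_form K f g)"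


section \<open>Pointwise values\<close>

fun iter_partial :: "'n list \<Rightarrow> (real ^ 'n \<Rightarrow> real) \<Rightarrow> real ^ 'n \<Rightarrow> real" where
  "iter_partial [] \<phi> = \<phi>"
| "iter_partial (i # is) \<phi> = (\<lambda>x. frechet_derivative (iter_partial is \<phi>) (at x) (axis i 1))"

definition schwartz :: "(real ^ 'n \<Rightarrow> real) \<Rightarrow> bool" where
  "schwartz \<phi> \<longleftrightarrow>
     (\<forall>is. (\<forall>x. iter_partial is \<phi> differentiable at x) \<and>
           (\<forall>k::nat. bounded (range (\<lambda>x. norm x ^ k * iter_partial is \<phi> x))))"

definition mollifier :: "(real ^ 'n \<Rightarrow> real) \<Rightarrow> bool" where
  "mollifier \<Phi> \<longleftrightarrow>
     schwartz \<Phi> \<and> (\<forall>y. 0 \<le> \<Phi> y) \<and> (\<forall>y. y \<notin> cube_set unit_cube \<longrightarrow> \<Phi> y = 0) \<and>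
     (LINT y|lebesgue. \<Phi> y) = 1"

definition rescaled :: "(real ^ 'n \<Rightarrow> real) \<Rightarrow> real ^ 'n \<Rightarrow> real \<Rightarrow> real ^ 'n \<Rightarrow> complex" where
  "rescaled \<Phi> x \<epsilon> = (\<lambda>y. complex_of_real (\<Phi> ((y - x) /\<^sub>R \<epsilon>) / \<epsilon> ^ CARD('n)))"

definition pointwise_value ::
  "((real ^ 'n \<Rightarrow> complex) \<Rightarrow> (real ^ 'n \<Rightarrow> complex) \<Rightarrow> complex) \<Rightarrow>
   (real ^ 'n \<Rightarrow> real ^ 'n \<Rightarrow> complex) \<Rightarrow> (real ^ 'n \<Rightarrow> real) \<Rightarrow>
   (real ^ 'n \<Rightarrow> complex) \<Rightarrow> real ^ 'n \<Rightarrow> complex" where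
  "pointwise_value T K \<Phi> f x = Lim (at_right 0) (\<lambda>\<epsilon>. pairing T K f (rescaled \<Phi> x \<epsilon>))"

end

theory Submission
  imports Defs
begin

text \<open>The kernel is continuous off the diagonal, so \<open>T f\<close> has the pointwise value
  \<open>\<integral> f(t) K(x,t) dt\<close> at every \<open>x \<notin> I\<close>: mollifying a function that is continuous near \<open>x\<close>
  recovers its value at \<open>x\<close>. Both estimates then reduce to bounds for \<open>K(x,t)\<close> and
  \<open>K(x,t) - K(x',t)\<close> that are uniform in \<open>t \<in> I\<close>. For \<open>x \<notin> 5I\<close> the quantities \<open>|x - t|\<close>,
  \<open>\<ell>(I) w\<^sub>I(x)\<close> and \<open>\<ell>(\<langle>I,x\<rangle>)\<close> are comparable, and \<open>rdist(\<langle>I,x\<rangle>, B)\<close> is at most a constant times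
  \<open>1 + |x + t| / (1 + |x - t|)\<close>, because \<open>2x = (x + t) + (x - t)\<close> bounds the distance of
  \<open>\<langle>I,x\<rangle>\<close> from the origin. The constant \<open>\<kappa> = 1/12\<close> absorbs all these comparisons.\<close>

section \<open>Cubes and the max norm\<close>

lemma infnorm_le_iff_cart:
  fixes x :: "real ^ 'n"
  shows "infnorm x \<le> r \<longleftrightarrow> (\<forall>i. \<bar>x $ i\<bar> \<le> r)"
proof
  show "infnorm x \<le> r \<Longrightarrow> \<forall>i. \<bar>x $ i\<bar> \<le> r"
    using component_le_infnorm_cart order_trans by blast
  show "infnorm x \<le> r" if "\<forall>i. \<bar>x $ i\<bar> \<le> r"
    unfolding infnorm_cart using that by (intro cSup_least) auto
qed

text \<open>Cubes are closed balls of the max norm, so later containments between cubes reduce to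
  the triangle inequality for \<open>infnorm\<close>.\<close>

lemma in_cube_set_iff:
  fixes Q :: "(real ^ 'n) cube"
  shows "y \<in> cube_set Q \<longleftrightarrow> infnorm (y - centre Q) \<le> side Q / 2"
  unfolding cube_set_def mem_box_cart infnorm_le_iff_cart
  by (intro all_cong1, unfold abs_le_iff) auto

lemma infnorm_diff_triangle:
  "infnorm (x - z) \<le> infnorm (x - y) + infnorm (y - z)"
  using infnorm_triangle[of "x - y" "y - z"] by simp

lemma infnorm_le_side:
  fixes Q :: "(real ^ 'n) cube"
  assumes "x \<in> cube_set Q" "y \<in> cube_set Q"
  shows "infnorm (x - y) \<le> side Q"
  using assms infnorm_diff_triangle[of x y "centre Q"] infnorm_sub[of "centre Q" y]
  by (simp add: in_cube_set_iff)

text \<open>Since \<open>hull_cube\<close> is a Hilbert choice, a minimiser has to be exhibited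
  before anything is known about it. An enclosing cube has side at least the longest edge
  \<open>s\<close> of the bounding box with edges \<open>[a i, b i]\<close>, and a cube of side
  \<open>s\<close> can cover that box.\<close>

lemma is_hull_cube_hull_cube:
  fixes I J :: "(real ^ 'n::{finite,linorder}) cube"
  assumes sI: "0 \<le> side I" and sJ: "0 \<le> side J"
  shows "is_hull_cube I J (hull_cube I J)"
proof -
  define a where "a i = min (centre I $ i - side I / 2) (centre J $ i - side J / 2)" for i
  define b where "b i = max (centre I $ i + side I / 2) (centre J $ i + side J / 2)" for i
  define s where "s = Max (range (\<lambda>i. b i - a i))"
  \<comment> \<open>Pushing the cube down in every coordinate makes the first coordinate of its centre minimal.\<close>
  define Q where "Q = Cube (\<chi> i. b i - s / 2) s"
  have ab: "a i \<le> b i" for i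
    using sI sJ by (auto simp: a_def b_def)
  have s_ge: "b i - a i \<le> s" for i
    unfolding s_def by (intro Max_ge) auto
  have s0: "0 \<le> s"
    using s_ge[of undefined] ab[of undefined] by linarith
  have memQ: "y \<in> cube_set Q" if "\<And>i. a i \<le> y $ i" "\<And>i. y $ i \<le> b i" for y
    unfolding cube_set_def mem_box_cart Q_def
  proof (intro allI conjI)
    fix i
    show "(centre (Cube (\<chi> i. b i - s / 2) s) - vec (side (Cube (\<chi> i. b i - s / 2) s) / 2)) $ i \<le> y $ i"
      using that(1)[of i] s_ge[of i] by simp
    show "y $ i \<le> (centre (Cube (\<chi> i. b i - s / 2) s) + vec (side (Cube (\<chi> i. b i - s / 2) s) / 2)) $ i"
      using that(2)[of i] by simp
  qed
  have enc: "encloses Q I J"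
    unfolding encloses_def
  proof (intro conjI Un_least subsetI)
    show "0 \<le> side Q" using s0 by (simp add: Q_def)
    show "y \<in> cube_set Q" if "y \<in> cube_set I" for y
      by (rule memQ) (use that in \<open>auto simp: cube_set_def mem_box_cart a_def b_def min_le_iff_disj le_max_iff_disj\<close>)
    show "y \<in> cube_set Q" if "y \<in> cube_set J" for y
      by (rule memQ) (use that in \<open>auto simp: cube_set_def mem_box_cart a_def b_def min_le_iff_disj le_max_iff_disj\<close>)
  qed
  \<comment> \<open>An enclosing cube contains two opposite corners of each of \<open>I\<close> and
    \<open>J\<close>, and these corners realise the extreme values \<open>a i\<close> and
    \<open>b i\<close>. The corners lie in their cubes because the sides are nonnegative.\<close>
  have bounds: "centre Q' $ i - side Q' / 2 \<le> a i \<and> b i \<le> centre Q' $ i + side Q' / 2"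
    if "encloses Q' I J" for Q' i
  proof -
    have "centre I - vec (side I / 2) \<in> cube_set I" "centre I + vec (side I / 2) \<in> cube_set I"
      "centre J - vec (side J / 2) \<in> cube_set J" "centre J + vec (side J / 2) \<in> cube_set J"
      using sI sJ by (auto simp: cube_set_def mem_box_cart)
    then have "centre I - vec (side I / 2) \<in> cube_set Q'" "centre I + vec (side I / 2) \<in> cube_set Q'"
      "centre J - vec (side J / 2) \<in> cube_set Q'" "centre J + vec (side J / 2) \<in> cube_set Q'"
      using that by (auto simp: encloses_def)
    then show ?thesis
      by (auto simp: cube_set_def mem_box_cart a_def b_def)
  qed
  have "side Q \<le> side Q'" if "encloses Q' I J" for Q'
  proof -
    have "b i - a i \<le> side Q'" for i
      using bounds[OF that, of i] by linarith
    then show ?thesis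
      by (auto simp: Q_def s_def)
  qed
  moreover have "centre Q $ i \<le> centre Q' $ i" if "encloses Q' I J" "side Q' = side Q" for Q' i
    using bounds[OF that(1), of i] that(2) by (simp add: Q_def)
  ultimately have "is_hull_cube I J Q"
    using enc by (auto simp: is_hull_cube_def)
  then show ?thesis
    unfolding hull_cube_def by (rule someI)
qed

lemma hull_cube_encloses:
  fixes I J :: "(real ^ 'n::{finite,linorder}) cube"
  assumes "0 \<le> side I" "0 \<le> side J"
  shows "encloses (hull_cube I J) I J"
  using is_hull_cube_hull_cube[OF assms] by (simp add: is_hull_cube_def)

lemma side_hull_cube_le:
  fixes I J :: "(real ^ 'n::{finite,linorder}) cube"
  assumes "0 \<le> side I" "0 \<le> side J" "encloses Q I J"
  shows "side (hull_cube I J) \<le> side Q"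
  using is_hull_cube_hull_cube[OF assms(1,2)] assms(3) by (simp add: is_hull_cube_def)

lemma cube_set_subset_iff_le:
  fixes P Q :: "(real ^ 'n) cube"
  assumes "infnorm (centre P - centre Q) + side P / 2 \<le> side Q / 2"
  shows "cube_set P \<subseteq> cube_set Q"
proof
  fix y assume "y \<in> cube_set P"
  then show "y \<in> cube_set Q"
    using assms infnorm_diff_triangle[of y "centre Q" "centre P"] by (simp add: in_cube_set_iff)
qed

section \<open>The geometry of \<open>x \<notin> 5I\<close>\<close>

context
  fixes I :: "(real ^ 'n::{finite,linorder}) cube" and x t :: "real ^ 'n::{finite,linorder}"
  assumes side_pos: "0 < side I" and x_far: "x \<notin> cube_set (dilate 5 I)" and t_in: "t \<in> cube_set I"
begin

lemma far_centre: "5 / 2 * side I < infnorm (x - centre I)"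
  using x_far by (simp add: in_cube_set_iff dilate_def)

text \<open>Half the side of \<open>I\<close> is less than a fifth of
  \<open>infnorm (x - centre I)\<close>, so passing from the centre to \<open>t\<close> keeps at
  least four fifths of the distance.\<close>

lemma far_centre_le: "infnorm (x - centre I) \<le> 5 / 4 * infnorm (x - t)"
  using far_centre t_in infnorm_diff_triangle[of x "centre I" t] by (simp add: in_cube_set_iff)

text \<open>The factor is 5/2 - 1/2. This margin also secures the smoothness condition
  \<open>2 * infnorm (x - x') < infnorm (x - t)\<close> once \<open>x'\<close> is within half a side
  of \<open>x\<close>.\<close>

lemma far_dist: "2 * side I < infnorm (x - t)"
  using far_centre t_in infnorm_diff_triangle[of x "centre I" t] by (simp add: in_cube_set_iff)

lemma hull_encloses: "encloses (hull_cube I (point_cube x)) I (point_cube x)"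
  using side_pos by (intro hull_cube_encloses) (auto simp: point_cube_def)

lemma x_in_hull: "x \<in> cube_set (hull_cube I (point_cube x))"
proof -
  have "x \<in> cube_set (point_cube x)"
    by (simp add: in_cube_set_iff point_cube_def infnorm_0)
  then show ?thesis
    using hull_encloses by (auto simp: encloses_def)
qed

lemma dist_le_side_hull: "infnorm (x - t) \<le> side (hull_cube I (point_cube x))"
proof -
  have "t \<in> cube_set (hull_cube I (point_cube x))"
    using hull_encloses t_in by (auto simp: encloses_def)
  then show ?thesis
    using x_in_hull by (intro infnorm_le_side)
qed

lemma side_hull_le_dist: "side (hull_cube I (point_cube x)) \<le> 5 / 2 * infnorm (x - t)"
proof -
  \<comment> \<open>The cube concentric with \<open>I\<close> whose boundary passes through
    \<open>x\<close>. Its side is at most 2 * 5/4 times the distance from \<open>x\<close> to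
    \<open>t\<close>.\<close>
  have "encloses (Cube (centre I) (2 * infnorm (x - centre I))) I (point_cube x)"
    unfolding encloses_def
  proof (intro conjI Un_least cube_set_subset_iff_le)
  qed (use far_centre side_pos infnorm_pos_le[of "x - centre I"] in \<open>auto simp: point_cube_def infnorm_0\<close>)
  then have "side (hull_cube I (point_cube x)) \<le> 2 * infnorm (x - centre I)"
    using side_hull_cube_le[of I "point_cube x"] side_pos by (fastforce simp: point_cube_def)
  then show ?thesis
    using far_centre_le by linarith
qed

text \<open>The source of the constant 12: a factor 6 from the side of a cube about the origin, and
  a factor 2 from bounding the denominator of \<open>rdist\<close> below by a mean.\<close>

lemma rdist_hull_le:
  "rdist (hull_cube I (point_cube x)) unit_cube / 12
    \<le> 1 + infnorm (x + t) / (1 + infnorm (x - t))"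
proof -
  define Q where "Q = hull_cube I (point_cube x)"
  define r where "r = infnorm (x - t)"
  define m where "m = infnorm (x + t)"
  have r0: "0 < r" and m0: "0 \<le> m"
    using far_dist side_pos infnorm_pos_le unfolding r_def m_def by (linarith, blast)
  have s: "r \<le> side Q" "side Q \<le> 5 / 2 * r"
    using dist_le_side_hull side_hull_le_dist by (simp_all add: Q_def r_def)
  have "infnorm (2 *\<^sub>R x) \<le> m + r"
    using infnorm_triangle[of "x + t" "x - t"] by (simp add: m_def r_def scaleR_2)
  moreover have "infnorm (2 *\<^sub>R x) = 2 * infnorm x"
    by (simp add: infnorm_mul)
  moreover have "infnorm (x - centre Q) \<le> side Q / 2"
    using x_in_hull by (simp add: in_cube_set_iff Q_def)
  ultimately have q: "infnorm (centre Q) \<le> side Q / 2 + m / 2 + r / 2"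
    using infnorm_diff_triangle[of "centre Q" 0 x] infnorm_sub[of x "centre Q"] by simp
  \<comment> \<open>Half the side of \<open>P\<close> is
    \<open>infnorm (centre Q) + side Q / 2 + 1 / 2\<close>, enough to cover \<open>Q\<close> and the
    unit cube at once.\<close>
  define P :: "(real ^ 'n::{finite,linorder}) cube" where "P = Cube 0 (2 * infnorm (centre Q) + side Q + 1)"
  have "encloses P Q unit_cube"
    unfolding encloses_def
  proof (intro conjI Un_least cube_set_subset_iff_le)
  qed (use infnorm_pos_le[of "centre Q"] s r0 in \<open>auto simp: P_def unit_cube_def infnorm_0\<close>)
  then have "side (hull_cube Q unit_cube) \<le> side P"
    using s r0 by (intro side_hull_cube_le) (auto simp: unit_cube_def)
  also have "\<dots> \<le> 6 * (1 + r) + m"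
    using q s r0 by (simp add: P_def)
  finally have "rdist Q unit_cube \<le> (6 * (1 + r) + m) / max (side Q) 1"
    unfolding rdist_def unit_cube_def by (simp add: divide_right_mono)
  \<comment> \<open>A maximum dominates the mean, and \<open>r \<le> side Q\<close>.\<close>
  also have "\<dots> \<le> (6 * (1 + r) + m) / ((1 + r) / 2)"
    using s r0 m0 by (intro divide_left_mono) auto
  also have "\<dots> = 12 + 2 * (m / (1 + r))"
    using r0 by (simp add: field_simps)
  also have "\<dots> \<le> 12 * (1 + m / (1 + r))"
    using m0 r0 by (simp add: field_simps)
  finally show ?thesis
    unfolding Q_def r_def m_def by (simp only: pos_divide_le_eq zero_less_numeral mult.commute)
qed

text \<open>The point \<open>y\<close> will be \<open>x\<close> itself in the size estimate and the
  midpoint of \<open>x\<close> and \<open>x'\<close> in the difference estimate. The left side is at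
  most 5/4 of the side plus the distance from \<open>x\<close> to the centre, hence at most 15/8 of
  the distance from \<open>x\<close> to \<open>t\<close>.\<close>

lemma side_wgt_le_dist:
  assumes "infnorm (x - y) \<le> side I / 4"
  shows "side I * wgt I y \<le> 2 * infnorm (x - t)"
proof -
  have "infnorm (y - centre I) \<le> side I / 4 + infnorm (x - centre I)"
    using assms infnorm_diff_triangle[of y "centre I" x] infnorm_sub[of x y] by linarith
  moreover have "side I * wgt I y = side I + infnorm (y - centre I)"
    using side_pos by (simp add: wgt_def field_simps)
  ultimately show ?thesis
    using far_centre far_centre_le side_pos by linarith
qed

text \<open>Turns the singularity of the kernel into the weight and a power of the side. It is
  applied with \<open>p\<close> equal to \<open>n\<close> and to
  \<open>n + \<delta>\<close>.\<close>

lemma inverse_dist_powr_le: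
  assumes "infnorm (x - y) \<le> side I / 4" "0 \<le> p"
  shows "inverse (infnorm (x - t) powr p) \<le> 2 powr p * wgt I y powr (- p) * side I powr (- p)"
proof -
  have w: "0 < wgt I y"
    using side_pos infnorm_pos_le[of "y - centre I"] by (simp add: wgt_def add_pos_nonneg)
  have "(side I * wgt I y) powr p \<le> (2 * infnorm (x - t)) powr p"
    using side_wgt_le_dist[OF assms(1)] w side_pos assms(2) by (intro powr_mono2) auto
  then have "side I powr p * wgt I y powr p \<le> 2 powr p * infnorm (x - t) powr p"
    using w side_pos by (simp add: powr_mult infnorm_pos_le)
  moreover have "0 < infnorm (x - t)"
    using far_dist side_pos by linarith
  ultimately show ?thesis
    using w side_pos by (simp add: powr_minus field_simps)
qed

end

section \<open>Mollification\<close>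

text \<open>Change of variables that undoes the rescaling of the mollifier.\<close>

lemma integral_lborel_affine:
  fixes h :: "'a::euclidean_space \<Rightarrow> 'b::{banach, second_countable_topology}"
  assumes h[measurable]: "h \<in> borel_measurable borel" and c: "c \<noteq> 0"
  shows "(LINT y|lborel. h y) = \<bar>c\<bar> ^ DIM('a) *\<^sub>R (LINT z|lborel. h (a + c *\<^sub>R z))"
proof -
  have "(LINT y|lborel. h y)
      = (LINT y|density (distr lborel borel (\<lambda>x. a + c *\<^sub>R x)) (\<lambda>_. \<bar>c\<bar> ^ DIM('a)). h y)"
    by (subst lborel_affine[OF c, of a]) simp
  also have "\<dots> = \<bar>c\<bar> ^ DIM('a) *\<^sub>R (LINT z|lborel. h (a + c *\<^sub>R z))"
    by (subst integral_density) (auto simp: integral_distr)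
  finally show ?thesis .
qed

lemma mollifier_continuous:
  assumes "mollifier \<Phi>"
  shows "continuous_on UNIV \<Phi>"
proof -
  have "\<forall>is. \<forall>x. iter_partial is \<Phi> differentiable at x"
    using assms by (simp add: mollifier_def schwartz_def)
  \<comment> \<open>The empty list of partial derivatives is the case of the function
    itself.\<close>
  from this[rule_format, of "[]"] show ?thesis
    by (simp add: continuous_on_eq_continuous_at differentiable_imp_continuous_within)
qed

text \<open>Passes from the max norm to Euclidean balls through the l1 norm. The crude radius
  \<open>n\<close> is harmless, since it gets multiplied by \<open>\<epsilon>\<close>, which tends
  to 0.\<close>

lemma mollifier_zero_outside:
  fixes \<Phi> :: "real ^ 'n \<Rightarrow> real"
  assumes "mollifier \<Phi>" "norm y > real CARD('n)"
  shows "\<Phi> y = 0"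
proof (rule ccontr)
  assume "\<Phi> y \<noteq> 0"
  then have "y \<in> cube_set unit_cube"
    using assms(1) by (auto simp: mollifier_def)
  then have "infnorm y \<le> 1"
    by (simp add: in_cube_set_iff unit_cube_def)
  then have "\<bar>y $ i\<bar> \<le> 1" for i
    using component_le_infnorm_cart order_trans by blast
  then have "(\<Sum>i\<in>UNIV. \<bar>y $ i\<bar>) \<le> (\<Sum>i\<in>(UNIV::'n set). 1)"
    by (intro sum_mono)
  then show False
    using norm_le_l1_cart[of y] assms(2) by simp
qed

lemma rescaled_zero_outside:
  fixes \<Phi> :: "real ^ 'n \<Rightarrow> real"
  assumes "mollifier \<Phi>" "0 < \<epsilon>" "dist x y > \<epsilon> * real CARD('n)"
  shows "rescaled \<Phi> x \<epsilon> y = 0"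
proof -
  have "norm ((y - x) /\<^sub>R \<epsilon>) > real CARD('n)"
    using assms(2,3) by (simp add: dist_norm norm_minus_commute divide_inverse_commute[symmetric] pos_less_divide_eq mult.commute)
  then show ?thesis
    using mollifier_zero_outside[OF assms(1)] by (simp add: rescaled_def)
qed

lemma supp_rescaled_subset:
  fixes \<Phi> :: "real ^ 'n \<Rightarrow> real"
  assumes "mollifier \<Phi>" "0 < \<epsilon>"
  shows "supp (rescaled \<Phi> x \<epsilon>) \<subseteq> cball x (\<epsilon> * real CARD('n))"
  unfolding supp_def
  by (rule closure_minimal) (use rescaled_zero_outside[OF assms] in \<open>auto simp: not_less[symmetric]\<close>)

lemma rescaled_in_Cc:
  fixes \<Phi> :: "real ^ 'n \<Rightarrow> real"
  assumes "mollifier \<Phi>" "0 < \<epsilon>"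
  shows "rescaled \<Phi> x \<epsilon> \<in> Cc"
proof -
  have "continuous_on UNIV (rescaled \<Phi> x \<epsilon>)"
    unfolding rescaled_def divide_inverse
    by (intro continuous_intros continuous_on_compose2[OF mollifier_continuous[OF assms(1)]]) auto
  moreover have "compact (supp (rescaled \<Phi> x \<epsilon>))"
    using supp_rescaled_subset[OF assms]
    by (metis bounded_cball bounded_subset compact_eq_bounded_closed closed_closure supp_def)
  ultimately show ?thesis
    by (simp add: Cc_def)
qed

lemma eventually_ball_avoids:
  fixes x :: "'a::metric_space"
  assumes "open U" "x \<in> U"
  shows "\<forall>\<^sub>F \<epsilon> in at_right (0::real). cball x (\<epsilon> * c) \<subseteq> U"
proof -
  obtain d where d: "d > 0" "ball x d \<subseteq> U"
    using assms by (meson openE)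
  have "((\<lambda>\<epsilon>::real. \<epsilon> * c) \<longlongrightarrow> 0 * c) (at_right 0)"
    by (intro tendsto_intros)
  then have "\<forall>\<^sub>F \<epsilon> in at_right (0::real). \<epsilon> * c < d"
    using d(1) by (intro order_tendstoD) auto
  then show ?thesis
    by eventually_elim (use d(2) in auto)
qed

text \<open>The approximate identity argument: after rescaling, the integral is an average, with
  weight \<open>\<Phi>\<close>, of values of \<open>G\<close> at points within
  \<open>\<epsilon> * n\<close> of \<open>x\<close>.\<close>

lemma mollification_tendsto:
  fixes \<Phi> :: "real ^ 'n \<Rightarrow> real" and G :: "real ^ 'n \<Rightarrow> complex"
  assumes m: "mollifier \<Phi>" and U: "open U" "x \<in> U" and G: "continuous_on U G"
  shows "((\<lambda>\<epsilon>. LINT y|lebesgue. rescaled \<Phi> x \<epsilon> y * G y) \<longlongrightarrow> G x) (at_right 0)"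
proof (rule tendstoI)
  fix e :: real assume e: "0 < e"
  define N where "N = real CARD('n)"
  \<comment> \<open>\<open>G\<close> is controlled only on \<open>U\<close>. Its truncation is Borel
    measurable and agrees with it on the support of the mollifier once \<open>\<epsilon>\<close> is
    small.\<close>
  define H where "H y = indicator U y *\<^sub>R G y" for y
  have H[measurable]: "H \<in> borel_measurable borel"
    unfolding H_def using U G by (intro borel_measurable_continuous_on_indicator) auto
  have \<Phi>_m[measurable]: "\<Phi> \<in> borel_measurable borel"
    by (rule borel_measurable_continuous_onI[OF mollifier_continuous[OF m]])
  have int1: "(LINT y|lebesgue. \<Phi> y) = 1"
    using m by (simp add: mollifier_def)
  then have "(LINT y|lborel. \<Phi> y) = 1"
    by (simp add: integral_completion)
  \<comment> \<open>The Bochner integral of a non-integrable function is 0, so the value 1 forces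
    integrability.\<close>
  then have \<Phi>_i: "integrable lborel \<Phi>" and \<Phi>_1: "(LINT y|lborel. \<Phi> y) = 1"
    using not_integrable_integral_eq by fastforce+
  have nn: "0 \<le> \<Phi> z" for z
    using m by (simp add: mollifier_def)
  \<comment> \<open>Half of \<open>e\<close> leaves room for the strict inequality, as the final
    bound is not strict.\<close>
  define V where "V = U \<inter> G -` ball (G x) (e / 2)"
  have "open V"
    unfolding V_def using G U by (intro continuous_open_preimage) auto
  moreover have "x \<in> V"
    using U e by (auto simp: V_def)
  ultimately have "\<forall>\<^sub>F \<epsilon> in at_right (0::real). cball x (\<epsilon> * N) \<subseteq> V"
    by (rule eventually_ball_avoids)
  moreover have "\<forall>\<^sub>F \<epsilon> in at_right (0::real). 0 < \<epsilon>"
    by (simp add: eventually_at_right_less)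
  ultimately show "\<forall>\<^sub>F \<epsilon> in at_right 0. dist (LINT y|lebesgue. rescaled \<Phi> x \<epsilon> y * G y) (G x) < e"
  proof eventually_elim
    case (elim \<epsilon>)
    have r_m[measurable]: "rescaled \<Phi> x \<epsilon> \<in> borel_measurable borel"
      using rescaled_in_Cc[OF m elim(2), of x] by (intro borel_measurable_continuous_onI) (simp add: Cc_def)
    have eq_H: "rescaled \<Phi> x \<epsilon> y * G y = rescaled \<Phi> x \<epsilon> y * H y" for y
      using rescaled_zero_outside[OF m elim(2), of x y] elim(1)
      by (cases "dist x y > \<epsilon> * N") (auto simp: N_def H_def V_def indicator_def subset_iff not_less)
    have "(LINT y|lebesgue. rescaled \<Phi> x \<epsilon> y * G y) = (LINT y|lborel. rescaled \<Phi> x \<epsilon> y * H y)"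
      unfolding eq_H by (intro integral_completion) measurable
    also have "\<dots> = \<epsilon> ^ CARD('n) *\<^sub>R (LINT z|lborel. rescaled \<Phi> x \<epsilon> (x + \<epsilon> *\<^sub>R z) * H (x + \<epsilon> *\<^sub>R z))"
      using elim(2) by (subst integral_lborel_affine[where c = \<epsilon> and a = x]) auto
    also have "\<dots> = (LINT z|lborel. \<epsilon> ^ CARD('n) *\<^sub>R (rescaled \<Phi> x \<epsilon> (x + \<epsilon> *\<^sub>R z) * H (x + \<epsilon> *\<^sub>R z)))"
      by simp
    also have "\<dots> = (LINT z|lborel. of_real (\<Phi> z) * H (x + \<epsilon> *\<^sub>R z))"
    proof -
      have "rescaled \<Phi> x \<epsilon> (x + \<epsilon> *\<^sub>R z) = of_real (\<Phi> z / \<epsilon> ^ CARD('n))" for z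
        using elim(2) by (simp add: rescaled_def)
      then show ?thesis
        using elim(2) by (simp add: scaleR_conv_of_real[where 'a = complex])
    qed
    finally have eq: "(LINT y|lebesgue. rescaled \<Phi> x \<epsilon> y * G y) = (LINT z|lborel. of_real (\<Phi> z) * H (x + \<epsilon> *\<^sub>R z))" .
    have close: "norm (H (x + \<epsilon> *\<^sub>R z) - G x) \<le> e / 2" if "\<Phi> z \<noteq> 0" for z
    proof -
      have "norm z \<le> N"
        using mollifier_zero_outside[OF m, of z] that by (auto simp: N_def not_less[symmetric])
      then have "x + \<epsilon> *\<^sub>R z \<in> cball x (\<epsilon> * N)"
        using elim(2) by (simp add: dist_norm)
      then have "x + \<epsilon> *\<^sub>R z \<in> V"
        using elim(1) by (rule subsetD[rotated])
      then show ?thesis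
        by (auto simp: V_def H_def dist_norm norm_minus_commute)
    qed
    have bd: "norm (of_real (\<Phi> z) * (H (x + \<epsilon> *\<^sub>R z) - G x)) \<le> \<Phi> z * (e / 2)" for z
      using close[of z] nn[of z] by (cases "\<Phi> z = 0") (auto simp: norm_mult mult_left_mono)
    have i1: "integrable lborel (\<lambda>z. of_real (\<Phi> z) * (H (x + \<epsilon> *\<^sub>R z) - G x))"
      by (rule Bochner_Integration.integrable_bound[of _ "\<lambda>z. \<Phi> z * (e / 2)"])
        (use \<Phi>_i bd nn e in \<open>auto intro!: AE_I2 simp: abs_of_nonneg\<close>)
    have i2: "integrable lborel (\<lambda>z. of_real (\<Phi> z) * G x)"
      using \<Phi>_i by (intro integrable_mult_left integrable_of_real) auto
    have "(LINT z|lborel. of_real (\<Phi> z) * H (x + \<epsilon> *\<^sub>R z))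
        = (LINT z|lborel. of_real (\<Phi> z) * (H (x + \<epsilon> *\<^sub>R z) - G x) + of_real (\<Phi> z) * G x)"
      by (simp add: algebra_simps)
    also have "\<dots> = (LINT z|lborel. of_real (\<Phi> z) * (H (x + \<epsilon> *\<^sub>R z) - G x)) + G x"
      using i1 i2 \<Phi>_1 by (simp del: integral_mult_right_zero)
    finally have "dist (LINT y|lebesgue. rescaled \<Phi> x \<epsilon> y * G y) (G x)
        = norm (LINT z|lborel. of_real (\<Phi> z) * (H (x + \<epsilon> *\<^sub>R z) - G x))"
      by (simp add: eq dist_norm)
    also have "\<dots> \<le> (LINT z|lborel. \<Phi> z * (e / 2))"
      using \<Phi>_i bd by (intro Bochner_Integration.integral_norm_bound_integral i1) auto
    also have "\<dots> = e / 2"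
      using \<Phi>_1 by simp
    finally show ?case
      using e by simp
  qed
qed

section \<open>The kernel and its pointwise integral\<close>

lemma cube_set_compact: "compact (cube_set Q)"
  by (simp add: cube_set_def)

text \<open>\<open>L\<close>, \<open>S\<close> and \<open>D\<close> are bounded, so they can be
  absorbed into the constant. This plain Holder form is what the continuity arguments use.\<close>

lemma kernel_holder:
  fixes K :: "real ^ 'n \<Rightarrow> real ^ 'n \<Rightarrow> complex"
  assumes "compact_CZ_kernel K \<delta> L S D"
  obtains A where "0 \<le> A"
    "\<And>t x t' x'. 2 * (infnorm (t - t') + infnorm (x - x')) < infnorm (t - x) \<Longrightarrow>
      norm (K t x - K t' x')
        \<le> A * ((infnorm (t - t') + infnorm (x - x')) powr \<delta> / infnorm (t - x) powr (real CARD('n) + \<delta>))"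
proof -
  obtain CK where CK: "CK > 0" and smooth:
    "\<And>t x t' x'. 2 * (infnorm (t - t') + infnorm (x - x')) < infnorm (t - x) \<Longrightarrow>
          norm (K t x - K t' x') \<le>
            CK * ((infnorm (t - t') + infnorm (x - x')) powr \<delta>
                   / infnorm (t - x) powr (real CARD('n) + \<delta>))
             * L (infnorm (t - x)) * S (infnorm (t - t') + infnorm (x - x'))
             * D (1 + infnorm (t + x) / (1 + infnorm (t - x)))"
    using assms unfolding compact_CZ_kernel_def by blast
  have adm: "admissible_LSD L S D"
    using assms by (simp add: compact_CZ_kernel_def)
  then have "bounded (L ` {0..})" "bounded (S ` {0..})" "bounded (D ` {0..})"
    by (simp_all add: admissible_LSD_def)
  then obtain BL BS BD where M: "0 < BL" "0 < BS" "0 < BD"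
      "\<And>y. 0 \<le> y \<Longrightarrow> L y \<le> BL" "\<And>y. 0 \<le> y \<Longrightarrow> S y \<le> BS" "\<And>y. 0 \<le> y \<Longrightarrow> D y \<le> BD"
    unfolding bounded_pos by (auto simp: abs_le_iff)
  have nn: "0 \<le> L y" "0 \<le> S y" "0 \<le> D y" if "0 \<le> y" for y
    using adm that by (simp_all add: admissible_LSD_def)
  show thesis
  proof
    show "0 \<le> CK * BL * BS * BD"
      using CK M by simp
    fix t x t' x' :: "real ^ 'n"
    define a where "a = infnorm (t - t') + infnorm (x - x')"
    define B where "B = a powr \<delta> / infnorm (t - x) powr (real CARD('n) + \<delta>)"
    define d where "d = 1 + infnorm (t + x) / (1 + infnorm (t - x))"
    have a: "0 \<le> a" "0 \<le> infnorm (t - x)" "0 \<le> d" "0 \<le> B"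
      by (auto simp: a_def d_def B_def infnorm_pos_le intro!: add_nonneg_nonneg divide_nonneg_nonneg)
    assume "2 * (infnorm (t - t') + infnorm (x - x')) < infnorm (t - x)"
    from smooth[OF this] have "norm (K t x - K t' x') \<le> CK * B * L (infnorm (t - x)) * S a * D d"
      by (simp add: a_def B_def d_def)
    also have "\<dots> \<le> CK * B * BL * BS * BD"
      using a CK M nn by (intro mult_mono mult_nonneg_nonneg order_refl) auto
    finally show "norm (K t x - K t' x') \<le> CK * BL * BS * BD *
      ((infnorm (t - t') + infnorm (x - x')) powr \<delta> / infnorm (t - x) powr (real CARD('n) + \<delta>))"
      by (simp add: a_def B_def mult_ac)
  qed
qed

lemma kernel_continuous:
  fixes K :: "real ^ 'n \<Rightarrow> real ^ 'n \<Rightarrow> complex"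
  assumes "compact_CZ_kernel K \<delta> L S D" "0 < \<delta>"
  shows "continuous_on (- {y}) (K y)"
proof -
  obtain A where "0 \<le> A" and A: "\<And>t x t' x'. 2 * (infnorm (t - t') + infnorm (x - x')) < infnorm (t - x) \<Longrightarrow>
      norm (K t x - K t' x')
        \<le> A * ((infnorm (t - t') + infnorm (x - x')) powr \<delta> / infnorm (t - x) powr (real CARD('n) + \<delta>))"
    using kernel_holder[OF assms(1)] by blast
  have "isCont (K y) t" if "t \<noteq> y" for t
  proof -
    define b where "b s = A * (infnorm (t - s) powr \<delta> / infnorm (y - t) powr (real CARD('n) + \<delta>))" for s
    have inf0: "((\<lambda>s. infnorm (t - s)) \<longlongrightarrow> infnorm (t - t)) (at t)"
      by (intro tendsto_intros)
    have "0 < infnorm (y - t)"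
      using that by (simp add: infnorm_pos_lt)
    then have "\<forall>\<^sub>F s in at t. infnorm (t - s) < infnorm (y - t) / 2"
      using inf0 by (intro order_tendstoD) (auto simp: infnorm_0)
    then have "\<forall>\<^sub>F s in at t. norm (K y s - K y t) \<le> b s"
    proof eventually_elim
      case (elim s)
      then show ?case
        using A[of y y t s] by (simp add: b_def infnorm_0 norm_minus_commute)
    qed
    moreover have "(b \<longlongrightarrow> A * (infnorm (t - t) powr \<delta> / infnorm (y - t) powr (real CARD('n) + \<delta>))) (at t)"
      \<comment> \<open>The power tends to 0 although its base has limit 0, because the exponent is
        positive and the base nonnegative.\<close>
      unfolding b_def using that assms(2)
      by (intro tendsto_mult tendsto_divide tendsto_const tendsto_powr' inf0)
        (auto simp: infnorm_eq_0 infnorm_pos_le intro!: always_eventually)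
    then have "(b \<longlongrightarrow> 0) (at t)"
      by (simp add: infnorm_0)
    ultimately have "((\<lambda>s. K y s - K y t) \<longlongrightarrow> 0) (at t)"
      by (rule Lim_null_comparison)
    then show ?thesis
      by (simp add: isCont_def LIM_zero_iff)
  qed
  then show ?thesis
    by (intro continuous_at_imp_continuous_on) auto
qed

section \<open>Integrals of \<open>f\<close> against the kernel, based at points off the
  cube\<close>

lemma integrable_mult_kernel:
  fixes K :: "real ^ 'n \<Rightarrow> real ^ 'n \<Rightarrow> complex"
  assumes "compact_CZ_kernel K \<delta> L S D" "0 < \<delta>"
    and f: "integrable lebesgue f" "\<And>t. t \<notin> cube_set I \<Longrightarrow> f t = 0" and y: "y \<notin> cube_set I"
  shows "integrable lebesgue (\<lambda>t. f t * K y t)"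
proof -
  have cont: "continuous_on (cube_set I) (K y)"
    using kernel_continuous[OF assms(1,2), of y] by (rule continuous_on_subset) (use y in auto)
  then have "bounded (K y ` cube_set I)"
    by (intro compact_imp_bounded compact_continuous_image cube_set_compact)
  then obtain M where M: "\<And>t. t \<in> cube_set I \<Longrightarrow> norm (K y t) \<le> M"
    unfolding bounded_iff by auto
  define k where "k t = indicator (cube_set I) t *\<^sub>R K y t" for t
  have "k \<in> borel_measurable borel"
    unfolding k_def using cont cube_set_compact[of I]
    by (intro borel_measurable_continuous_on_indicator) (auto simp: compact_imp_closed)
  then have k: "k \<in> borel_measurable lebesgue"
    by (simp add: measurable_completion)
  have eq: "f t * K y t = f t * k t" for t
    using f(2)[of t] by (auto simp: k_def indicator_def)
  have le: "norm (f t * k t) \<le> norm (norm (f t) * M)" for t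
    using M[of t] f(2)[of t] by (cases "t \<in> cube_set I") (auto simp: k_def norm_mult abs_mult intro!: mult_left_mono)
  show ?thesis
    unfolding eq
    by (rule Bochner_Integration.integrable_bound[of _ "\<lambda>t. norm (f t) * M"])
      (use f(1) k le in auto)
qed

text \<open>Both integrands vanish off \<open>I\<close>, so a uniform kernel bound on
  \<open>I\<close> is enough.\<close>

lemma kernel_integral_diff_le:
  fixes K :: "real ^ 'n \<Rightarrow> real ^ 'n \<Rightarrow> complex"
  assumes "compact_CZ_kernel K \<delta> L S D" "0 < \<delta>"
    and f: "integrable lebesgue f" "\<And>t. t \<notin> cube_set I \<Longrightarrow> f t = 0"
    and y: "y \<notin> cube_set I" "y' \<notin> cube_set I"
    and le: "\<And>t. t \<in> cube_set I \<Longrightarrow> norm (K y t - K y' t) \<le> b"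
  shows "norm ((LINT t|lebesgue. f t * K y t) - (LINT t|lebesgue. f t * K y' t))
    \<le> b * (LINT t|lebesgue. norm (f t))"
proof -
  note i = integrable_mult_kernel[OF assms(1,2) f y(1)] integrable_mult_kernel[OF assms(1,2) f y(2)]
  have pt: "norm (f t * K y t - f t * K y' t) \<le> b * norm (f t)" for t
    using le[of t] f(2)[of t]
    by (cases "t \<in> cube_set I")
      (auto simp: right_diff_distrib[symmetric] norm_mult mult.commute[of b] intro!: mult_left_mono)
  have "norm ((LINT t|lebesgue. f t * K y t) - (LINT t|lebesgue. f t * K y' t))
      = norm (LINT t|lebesgue. f t * K y t - f t * K y' t)"
    using i by simp
  also have "\<dots> \<le> (LINT t|lebesgue. b * norm (f t))"
    using i f(1) pt by (intro Bochner_Integration.integral_norm_bound_integral) auto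
  finally show ?thesis
    by simp
qed

lemma kernel_integral_le:
  fixes K :: "real ^ 'n \<Rightarrow> real ^ 'n \<Rightarrow> complex"
  assumes "compact_CZ_kernel K \<delta> L S D" "0 < \<delta>"
    and f: "integrable lebesgue f" "\<And>t. t \<notin> cube_set I \<Longrightarrow> f t = 0"
    and y: "y \<notin> cube_set I"
    and le: "\<And>t. t \<in> cube_set I \<Longrightarrow> norm (K y t) \<le> b"
  shows "norm (LINT t|lebesgue. f t * K y t) \<le> b * (LINT t|lebesgue. norm (f t))"
proof -
  have "norm (f t * K y t) \<le> b * norm (f t)" for t
    using le[of t] f(2)[of t]
    by (cases "t \<in> cube_set I") (auto simp: norm_mult mult.commute[of b] intro!: mult_left_mono)
  then have "norm (LINT t|lebesgue. f t * K y t) \<le> (LINT t|lebesgue. b * norm (f t))"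
    using integrable_mult_kernel[OF assms(1,2) f y] f(1)
    by (intro Bochner_Integration.integral_norm_bound_integral) auto
  then show ?thesis
    by simp
qed

text \<open>A point off \<open>I\<close> has a positive gap \<open>d\<close> to \<open>I\<close>,
  which makes the Holder bound uniform in \<open>t\<close>.\<close>

lemma kernel_integral_continuous:
  fixes K :: "real ^ 'n \<Rightarrow> real ^ 'n \<Rightarrow> complex"
  assumes K: "compact_CZ_kernel K \<delta> L S D" and \<delta>: "0 < \<delta>"
    and f: "integrable lebesgue f" "\<And>t. t \<notin> cube_set I \<Longrightarrow> f t = 0"
  shows "continuous_on (- cube_set I) (\<lambda>y. LINT t|lebesgue. f t * K y t)"
proof -
  define G where "G y = (LINT t|lebesgue. f t * K y t)" for y
  obtain A where A0: "0 \<le> A" and A: "\<And>t x t' x'. 2 * (infnorm (t - t') + infnorm (x - x')) < infnorm (t - x) \<Longrightarrow>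
      norm (K t x - K t' x')
        \<le> A * ((infnorm (t - t') + infnorm (x - x')) powr \<delta> / infnorm (t - x) powr (real CARD('n) + \<delta>))"
    using kernel_holder[OF K] by blast
  have "isCont G x" if x: "x \<notin> cube_set I" for x
  proof -
    define d where "d = infnorm (x - centre I) - side I / 2"
    have d: "0 < d"
      using x by (simp add: d_def in_cube_set_iff)
    have far: "d \<le> infnorm (x - t)" if "t \<in> cube_set I" for t
      using that infnorm_diff_triangle[of x "centre I" t] by (simp add: d_def in_cube_set_iff)
    define N where "N = (LINT t|lebesgue. norm (f t))"
    define b where "b y = A * (infnorm (x - y) powr \<delta> / d powr (real CARD('n) + \<delta>)) * N" for y
    have inf0: "((\<lambda>s. infnorm (x - s)) \<longlongrightarrow> infnorm (x - x)) (at x)"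
      by (intro tendsto_intros)
    \<comment> \<open>With radius \<open>d / 2\<close> the smoothness condition holds for every
      \<open>t\<close> in \<open>I\<close>, and \<open>y\<close> stays off \<open>I\<close>.\<close>
    then have "\<forall>\<^sub>F y in at x. infnorm (x - y) < d / 2"
      using d by (intro order_tendstoD) (auto simp: infnorm_0)
    then have "\<forall>\<^sub>F y in at x. norm (G y - G x) \<le> b y"
    proof eventually_elim
      case (elim y)
      have "y \<notin> cube_set I"
        using elim d far[of y] by auto
      moreover have "norm (K x t - K y t) \<le> A * (infnorm (x - y) powr \<delta> / d powr (real CARD('n) + \<delta>))"
        if t: "t \<in> cube_set I" for t
      proof -
        have "norm (K x t - K y t) \<le> A * (infnorm (x - y) powr \<delta> / infnorm (x - t) powr (real CARD('n) + \<delta>))"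
          using A[of x y t t] far[OF t] elim by (simp add: infnorm_0)
        also have "\<dots> \<le> A * (infnorm (x - y) powr \<delta> / d powr (real CARD('n) + \<delta>))"
          using A0 d far[OF t] \<delta> by (intro mult_left_mono divide_left_mono powr_mono2) auto
        finally show ?thesis .
      qed
      ultimately have "norm (G x - G y) \<le> b y"
        unfolding G_def b_def N_def using x by (intro kernel_integral_diff_le[OF K \<delta> f])
      then show ?case
        by (simp add: norm_minus_commute)
    qed
    moreover have "(b \<longlongrightarrow> A * (infnorm (x - x) powr \<delta> / d powr (real CARD('n) + \<delta>)) * N) (at x)"
      unfolding b_def using d \<delta>
      by (intro tendsto_mult tendsto_divide tendsto_const tendsto_powr' inf0)
        (auto simp: infnorm_eq_0 infnorm_pos_le intro!: always_eventually)
    then have "(b \<longlongrightarrow> 0) (at x)"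
      by (simp add: infnorm_0)
    ultimately have "((\<lambda>y. G y - G x) \<longlongrightarrow> 0) (at x)"
      by (rule Lim_null_comparison)
    then show ?thesis
      by (simp add: isCont_def LIM_zero_iff)
  qed
  then show ?thesis
    unfolding G_def by (intro continuous_at_imp_continuous_on) auto
qed

text \<open>Near \<open>x\<close> the pairing is the mollification of a continuous function, so the
  limit is its value at \<open>x\<close>.\<close>

lemma pointwise_value_eq:
  fixes K :: "real ^ 'n \<Rightarrow> real ^ 'n \<Rightarrow> complex"
  assumes K: "compact_CZ_kernel K \<delta> L S D" and \<delta>: "0 < \<delta>"
    and T: "associated T K" and \<Phi>: "mollifier \<Phi>"
    and f: "integrable lebesgue f" "\<And>t. t \<notin> cube_set I \<Longrightarrow> f t = 0"
    and x: "x \<notin> cube_set I"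
  shows "pointwise_value T K \<Phi> f x = (LINT t|lebesgue. f t * K x t)"
proof -
  define G where "G y = (LINT t|lebesgue. f t * K y t)" for y
  have op: "open (- cube_set I)"
    using cube_set_compact[of I] by (simp add: compact_imp_closed open_Compl)
  have suppf: "supp f \<subseteq> cube_set I"
    unfolding supp_def using cube_set_compact[of I] f(2)
    by (intro closure_minimal) (auto simp: compact_imp_closed)
  \<comment> \<open>\<open>g\<close> does not depend on the inner variable, so it leaves the inner
    integral; no exchange of integrals occurs.\<close>
  have form: "kernel_form K f g = (LINT y|lebesgue. g y * G y)" for g
  proof -
    have "(LINT t|lebesgue. f t * g y * K y t) = g y * G y" for y
    proof -
      have "f t * g y * K y t = g y * (f t * K y t)" for t
        by (simp add: mult_ac)
      then show ?thesis
        by (simp only: G_def integral_mult_right_zero)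
    qed
    then show ?thesis
      by (simp add: kernel_form_def)
  qed
  have "((\<lambda>\<epsilon>. LINT y|lebesgue. rescaled \<Phi> x \<epsilon> y * G y) \<longlongrightarrow> G x) (at_right 0)"
    using \<Phi> op x kernel_integral_continuous[OF K \<delta> f] unfolding G_def
    by (intro mollification_tendsto) auto
  moreover have "\<forall>\<^sub>F \<epsilon> in at_right (0::real). cball x (\<epsilon> * real CARD('n)) \<subseteq> - cube_set I"
    using op x by (intro eventually_ball_avoids) auto
  then have "\<forall>\<^sub>F \<epsilon> in at_right 0. pairing T K f (rescaled \<Phi> x \<epsilon>) = (LINT y|lebesgue. rescaled \<Phi> x \<epsilon> y * G y)"
    using eventually_at_right_less[of "0::real"]
  proof eventually_elim
    case (elim \<epsilon>)
    have "supp f \<inter> supp (rescaled \<Phi> x \<epsilon>) = {}"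
      using suppf supp_rescaled_subset[OF \<Phi> elim(2), of x] elim(1) by blast
    \<comment> \<open>For \<open>f\<close> in \<open>Cc\<close> the pairing is \<open>T\<close>
      itself, and the association with \<open>K\<close> applies since the supports are disjoint.
      Otherwise \<open>pairing\<close> is the kernel form by definition.\<close>
    then have "f \<in> Cc \<Longrightarrow> T f (rescaled \<Phi> x \<epsilon>) = kernel_form K f (rescaled \<Phi> x \<epsilon>)"
      using T rescaled_in_Cc[OF \<Phi> elim(2), of x] by (simp add: associated_def)
    then show ?case
      by (simp add: pairing_def form)
  qed
  ultimately have "((\<lambda>\<epsilon>. pairing T K f (rescaled \<Phi> x \<epsilon>)) \<longlongrightarrow> G x) (at_right 0)"
    using tendsto_cong by fast
  then show ?thesis
    unfolding pointwise_value_def G_def by (intro tendsto_Lim) auto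
qed

section \<open>The kernel estimates on a cube\<close>

text \<open>Shaped like the kernel bounds, so that the power, \<open>L\<close>, \<open>S\<close> and
  \<open>D\<close> can be estimated separately.\<close>

lemma mult_mono5:
  fixes c :: real
  assumes "p \<le> p'" "l \<le> l'" "s \<le> s'" "d \<le> d'" "0 \<le> c" "0 \<le> p" "0 \<le> l" "0 \<le> s" "0 \<le> d"
  shows "c * p * l * s * d \<le> c * p' * l' * s' * d'"
  using assms by (intro mult_mono mult_nonneg_nonneg order_refl) auto

text \<open>The two factors common to both estimates. \<open>S\<close> is treated separately because
  its argument differs between them.\<close>

lemma decay_factors_le:
  fixes I :: "(real ^ 'n::{finite,linorder}) cube"
  assumes adm: "admissible_LSD L S D"
    and I: "0 < side I" "x \<notin> cube_set (dilate 5 I)" "t \<in> cube_set I"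
  shows "L (infnorm (x - t)) \<le> L (1 / 12 * side (hull_cube I (point_cube x)))"
    and "D (1 + infnorm (x + t) / (1 + infnorm (x - t)))
      \<le> D (1 / 12 * rdist (hull_cube I (point_cube x)) unit_cube)"
proof -
  define Q where "Q = hull_cube I (point_cube x)"
  have r0: "0 < infnorm (x - t)"
    using far_dist[OF I] I(1) by simp
  have s: "infnorm (x - t) \<le> side Q" "side Q \<le> 5 / 2 * infnorm (x - t)"
    using dist_le_side_hull[OF I] side_hull_le_dist[OF I] by (simp_all add: Q_def)
  have rd0: "0 \<le> rdist Q unit_cube"
    using hull_cube_encloses[of Q unit_cube] s r0
    by (simp add: rdist_def encloses_def unit_cube_def)
  have d0: "0 \<le> 1 + infnorm (x + t) / (1 + infnorm (x - t))"
    by (intro add_nonneg_nonneg divide_nonneg_nonneg infnorm_pos_le) auto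
  have "antimono_on {0..} L" "antimono_on {0..} D"
    using adm by (simp_all add: admissible_LSD_def)
  note mono = this[THEN monotone_onD]
  \<comment> \<open>\<open>L\<close> is non-increasing, and a twelfth of \<open>side Q\<close> is at
    most 5/24 of the distance.\<close>
  have "L (infnorm (x - t)) \<le> L (1 / 12 * side Q)"
    by (rule mono(1)) (use r0 s in auto)
  then show "L (infnorm (x - t)) \<le> L (1 / 12 * side (hull_cube I (point_cube x)))"
    by (simp only: Q_def)
  have "D (1 + infnorm (x + t) / (1 + infnorm (x - t))) \<le> D (1 / 12 * rdist Q unit_cube)"
    by (rule mono(2)) (use rd0 d0 rdist_hull_le[OF I] in \<open>simp_all only: Q_def atLeast_iff times_divide_eq_left mult_1 divide_nonneg_nonneg zero_le_numeral\<close>)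
  then show "D (1 + infnorm (x + t) / (1 + infnorm (x - t)))
      \<le> D (1 / 12 * rdist (hull_cube I (point_cube x)) unit_cube)"
    by (simp only: Q_def)
qed

text \<open>The weight comes from \<open>inverse_dist_powr_le\<close> at \<open>y = x\<close> with
  exponent \<open>n\<close>, where the power of the side is exactly the inverse volume.\<close>

lemma kernel_le_far:
  fixes K :: "real ^ 'n::{finite,linorder} \<Rightarrow> real ^ 'n::{finite,linorder} \<Rightarrow> complex"
  assumes adm: "admissible_LSD L S D" and "0 < CK"
    and I: "0 < side I" "x \<notin> cube_set (dilate 5 I)" "t \<in> cube_set I"
    and size: "norm (K x t) \<le> CK * (1 / infnorm (x - t) ^ CARD('n))
             * L (infnorm (x - t)) * S (infnorm (x - t))
             * D (1 + infnorm (x + t) / (1 + infnorm (x - t)))"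
  shows "norm (K x t) \<le> CK * 2 powr real CARD('n) * wgt I x powr (- real CARD('n))
    * F_K (\<lambda>y. L (1 / 12 * y)) (\<lambda>y. S (inverse (1 / 12) * y)) (\<lambda>y. D (1 / 12 * y))
        (hull_cube I (point_cube x)) * inverse (vol I)"
proof -
  define Q where "Q = hull_cube I (point_cube x)"
  define r where "r = infnorm (x - t)"
  define n where "n = real CARD('n)"
  have r0: "0 < r"
    using far_dist[OF I] I(1) by (simp add: r_def)
  have s: "r \<le> side Q"
    using dist_le_side_hull[OF I] by (simp add: Q_def r_def)
  note adm' = adm[unfolded admissible_LSD_def]
  have L: "L r \<le> L (1 / 12 * side Q)"
    using decay_factors_le(1)[OF adm I] by (simp only: Q_def r_def)
  have S: "S r \<le> S (inverse (1 / 12) * side Q)"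
    using adm' s r0 by (auto simp: monotone_on_def)
  have D: "D (1 + infnorm (x + t) / (1 + r)) \<le> D (1 / 12 * rdist Q unit_cube)"
    using decay_factors_le(2)[OF adm I] by (simp only: Q_def r_def)
  have P: "1 / r ^ CARD('n) \<le> 2 powr n * wgt I x powr (- n) * inverse (vol I)"
  proof -
    have "inverse (r powr n) \<le> 2 powr n * wgt I x powr (- n) * side I powr (- n)"
      unfolding r_def using I(1)
      by (intro inverse_dist_powr_le[OF I]) (auto simp: infnorm_0 n_def)
    then show ?thesis
      using r0 I(1) by (simp add: n_def powr_realpow powr_minus vol_def divide_inverse)
  qed
  have nn: "0 \<le> L y" "0 \<le> S y" "0 \<le> D y" if "0 \<le> y" for y
    using adm' that by simp_all
  have "0 \<le> 1 + infnorm (x + t) / (1 + r)"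
    using r0 infnorm_pos_le[of "x + t"] by simp
  then have "CK * (1 / r ^ CARD('n)) * L r * S r * D (1 + infnorm (x + t) / (1 + r))
      \<le> CK * (2 powr n * wgt I x powr (- n) * inverse (vol I))
      * L (1 / 12 * side Q) * S (inverse (1 / 12) * side Q) * D (1 / 12 * rdist Q unit_cube)"
    using r0 \<open>0 < CK\<close> by (intro mult_mono5 P L S D nn) auto
  note order_trans[OF size[folded r_def] this]
  then show ?thesis
    by (simp only: F_K_def Q_def n_def mult_ac)
qed

text \<open>Here \<open>inverse_dist_powr_le\<close> is used at the midpoint, which is less than a
  quarter side from \<open>x\<close>. Its exponent \<open>n + \<delta>\<close> splits the power of
  the side into the inverse volume and the denominator of the Holder quotient.\<close>

lemma kernel_diff_le_far:
  fixes K :: "real ^ 'n::{finite,linorder} \<Rightarrow> real ^ 'n::{finite,linorder} \<Rightarrow> complex"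
  assumes adm: "admissible_LSD L S D" and "0 < CK" "0 < \<delta>"
    and I: "0 < side I" "x \<notin> cube_set (dilate 5 I)" "t \<in> cube_set I"
    and x': "infnorm (x - x') < side I / 2"
    and smooth: "norm (K x t - K x' t) \<le> CK * (infnorm (x - x') powr \<delta>
                   / infnorm (x - t) powr (real CARD('n) + \<delta>))
             * L (infnorm (x - t)) * S (infnorm (x - x'))
             * D (1 + infnorm (x + t) / (1 + infnorm (x - t)))"
  shows "norm (K x t - K x' t) \<le> CK * 2 powr (real CARD('n) + \<delta>)
    * (infnorm (x - x') powr \<delta> / side I powr \<delta>)
    * wgt I ((x + x') /\<^sub>R 2) powr (- (real CARD('n) + \<delta>))
    * L (1 / 12 * side (hull_cube I (point_cube x)))
    * S (inverse (1 / 12) * infnorm (x - x'))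
    * D (1 / 12 * rdist (hull_cube I (point_cube x)) unit_cube) * inverse (vol I)"
proof -
  define Q where "Q = hull_cube I (point_cube x)"
  define r where "r = infnorm (x - t)"
  define a where "a = infnorm (x - x')"
  define p where "p = real CARD('n) + \<delta>"
  define w where "w = wgt I ((x + x') /\<^sub>R 2)"
  have r0: "0 < r"
    using far_dist[OF I] I(1) by (simp add: r_def)
  have a0: "0 \<le> a"
    by (simp add: a_def infnorm_pos_le)
  have s: "r \<le> side Q"
    using dist_le_side_hull[OF I] by (simp add: Q_def r_def)
  note adm' = adm[unfolded admissible_LSD_def]
  have L: "L r \<le> L (1 / 12 * side Q)"
    using decay_factors_le(1)[OF adm I] by (simp only: Q_def r_def)
  have S: "S a \<le> S (inverse (1 / 12) * a)"
    using adm' a0 by (auto simp: monotone_on_def)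
  have D: "D (1 + infnorm (x + t) / (1 + r)) \<le> D (1 / 12 * rdist Q unit_cube)"
    using decay_factors_le(2)[OF adm I] by (simp only: Q_def r_def)
  have P: "a powr \<delta> / r powr p \<le> a powr \<delta> * (2 powr p * w powr (- p) * (inverse (vol I) / side I powr \<delta>))"
  proof -
    have "x - (x + x') /\<^sub>R 2 = (1 / 2) *\<^sub>R (x - x')"
      by (simp add: vec_eq_iff field_simps)
    then have "infnorm (x - (x + x') /\<^sub>R 2) = a / 2"
      by (simp add: infnorm_mul a_def)
    then have "inverse (r powr p) \<le> 2 powr p * w powr (- p) * side I powr (- p)"
      unfolding r_def w_def using x' \<open>0 < \<delta>\<close>
      by (intro inverse_dist_powr_le[OF I]) (auto simp: p_def a_def)
    also have "side I powr (- p) = inverse (vol I) / side I powr \<delta>"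
    proof -
      have "side I powr p = vol I * side I powr \<delta>"
        using I(1) by (simp add: p_def powr_add powr_realpow vol_def)
      then show ?thesis
        by (simp add: powr_minus divide_inverse)
    qed
    finally show ?thesis
      unfolding divide_inverse[of "a powr \<delta>"] by (intro mult_left_mono) auto
  qed
  have nn: "0 \<le> L y" "0 \<le> S y" "0 \<le> D y" if "0 \<le> y" for y
    using adm' that by simp_all
  have "0 \<le> 1 + infnorm (x + t) / (1 + r)"
    using r0 infnorm_pos_le[of "x + t"] by simp
  then have "CK * (a powr \<delta> / r powr p) * L r * S a * D (1 + infnorm (x + t) / (1 + r))
      \<le> CK * (a powr \<delta> * (2 powr p * w powr (- p) * (inverse (vol I) / side I powr \<delta>)))
        * L (1 / 12 * side Q) * S (inverse (1 / 12) * a) * D (1 / 12 * rdist Q unit_cube)"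
    using r0 a0 \<open>0 < CK\<close> by (intro mult_mono5 P L S D nn) auto
  note order_trans[OF smooth[folded r_def a_def p_def] this]
  then show ?thesis
    by (simp only: Q_def a_def p_def w_def divide_inverse mult_ac)
qed

section \<open>Integration of the two kernel estimates against \<open>f\<close>\<close>

theorem proposition4p5:
  fixes \<delta> :: real
  assumes "0 < \<delta>" and "\<delta> < 1"
  shows "\<exists>\<kappa>. 0 < \<kappa> \<and> \<kappa> \<le> 1 \<and>
    (\<forall>(K :: real ^ 'n::{finite,linorder} \<Rightarrow> real ^ 'n::{finite,linorder} \<Rightarrow> complex) L S D T \<Phi>.
       compact_CZ_kernel K \<delta> L S D \<and> cont_linear_op T \<and> associated T K \<and> mollifier \<Phi> \<longrightarrow>
       (\<exists>C>0. \<forall>(f :: real ^ 'n::{finite,linorder} \<Rightarrow> complex) I.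
          0 < side I \<and> integrable lebesgue f \<and> (\<forall>t. t \<notin> cube_set I \<longrightarrow> f t = 0) \<longrightarrow>
          (\<forall>x. x \<notin> cube_set (dilate 5 I) \<longrightarrow>
             norm (pointwise_value T K \<Phi> f x) \<le>
               C * wgt I x powr (- real CARD('n))
                 * F_K (\<lambda>y. L (\<kappa> * y)) (\<lambda>y. S (inverse \<kappa> * y)) (\<lambda>y. D (\<kappa> * y))
                     (hull_cube I (point_cube x))
                 * inverse (vol I) * (LINT t:cube_set I|lebesgue. norm (f t))) \<and>
          (\<forall>x x'. infnorm (x - x') < side I / 2 \<and>
             cube_set (hull_cube (point_cube x) (point_cube x')) \<inter> cube_set (dilate 5 I) = {} \<longrightarrow>
             norm (pointwise_value T K \<Phi> f x - pointwise_value T K \<Phi> f x') \<le>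
               C * (infnorm (x - x') powr \<delta> / side I powr \<delta>)
                 * wgt I ((x + x') /\<^sub>R 2) powr (- (real CARD('n) + \<delta>))
                 * L (\<kappa> * side (hull_cube I (point_cube x)))
                 * S (inverse \<kappa> * infnorm (x - x'))
                 * D (\<kappa> * rdist (hull_cube I (point_cube x)) unit_cube)
                 * inverse (vol I) * (LINT t:cube_set I|lebesgue. norm (f t)))))"
proof (rule exI[of _ "1 / 12"], intro conjI allI impI)
  fix K :: "real ^ 'n::{finite,linorder} \<Rightarrow> real ^ 'n::{finite,linorder} \<Rightarrow> complex" and L S D T
    and \<Phi> :: "real ^ 'n::{finite,linorder} \<Rightarrow> real"
  assume *: "compact_CZ_kernel K \<delta> L S D \<and> cont_linear_op T \<and> associated T K \<and> mollifier \<Phi>"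
  then have K: "compact_CZ_kernel K \<delta> L S D" and T: "associated T K" and \<Phi>: "mollifier \<Phi>"
    by auto
  have adm: "admissible_LSD L S D"
    using K by (simp add: compact_CZ_kernel_def)
  obtain CK where CK: "CK > 0" and smooth:
    "\<And>t x t' x'. 2 * (infnorm (t - t') + infnorm (x - x')) < infnorm (t - x) \<Longrightarrow>
          norm (K t x - K t' x') \<le>
            CK * ((infnorm (t - t') + infnorm (x - x')) powr \<delta>
                   / infnorm (t - x) powr (real CARD('n) + \<delta>))
             * L (infnorm (t - x)) * S (infnorm (t - t') + infnorm (x - x'))
             * D (1 + infnorm (t + x) / (1 + infnorm (t - x)))"
    and size: "\<And>t x. t \<noteq> x \<Longrightarrow>
          norm (K t x) \<le>
            CK * (1 / infnorm (t - x) ^ CARD('n))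
             * L (infnorm (t - x)) * S (infnorm (t - x))
             * D (1 + infnorm (t + x) / (1 + infnorm (t - x)))"
    using K unfolding compact_CZ_kernel_def by blast
  \<comment> \<open>Lets the larger constant of the difference estimate serve both bounds.\<close>
  have CK_le: "CK * 2 powr real CARD('n) \<le> CK * 2 powr (real CARD('n) + \<delta>)"
    using CK assms by (intro mult_left_mono powr_mono) auto
  let ?C = "CK * 2 powr (real CARD('n) + \<delta>)"
  show "\<exists>C>0. \<forall>(f :: real ^ 'n::{finite,linorder} \<Rightarrow> complex) I.
          0 < side I \<and> integrable lebesgue f \<and> (\<forall>t. t \<notin> cube_set I \<longrightarrow> f t = 0) \<longrightarrow>
          (\<forall>x. x \<notin> cube_set (dilate 5 I) \<longrightarrow>
             norm (pointwise_value T K \<Phi> f x) \<le>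
               C * wgt I x powr (- real CARD('n))
                 * F_K (\<lambda>y. L (1 / 12 * y)) (\<lambda>y. S (inverse (1 / 12) * y)) (\<lambda>y. D (1 / 12 * y))
                     (hull_cube I (point_cube x))
                 * inverse (vol I) * (LINT t:cube_set I|lebesgue. norm (f t))) \<and>
          (\<forall>x x'. infnorm (x - x') < side I / 2 \<and>
             cube_set (hull_cube (point_cube x) (point_cube x')) \<inter> cube_set (dilate 5 I) = {} \<longrightarrow>
             norm (pointwise_value T K \<Phi> f x - pointwise_value T K \<Phi> f x') \<le>
               C * (infnorm (x - x') powr \<delta> / side I powr \<delta>)
                 * wgt I ((x + x') /\<^sub>R 2) powr (- (real CARD('n) + \<delta>))
                 * L (1 / 12 * side (hull_cube I (point_cube x)))
                 * S (inverse (1 / 12) * infnorm (x - x'))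
                 * D (1 / 12 * rdist (hull_cube I (point_cube x)) unit_cube)
                 * inverse (vol I) * (LINT t:cube_set I|lebesgue. norm (f t)))"
  proof (rule exI[of _ ?C], intro conjI allI impI)
    show "0 < ?C"
      using CK by simp
    fix f :: "real ^ 'n::{finite,linorder} \<Rightarrow> complex" and I
    assume fI: "0 < side I \<and> integrable lebesgue f \<and> (\<forall>t. t \<notin> cube_set I \<longrightarrow> f t = 0)"
    then have side: "0 < side I" and f: "integrable lebesgue f" "\<And>t. t \<notin> cube_set I \<Longrightarrow> f t = 0"
      by auto
    have norm_f: "(LINT t:cube_set I|lebesgue. norm (f t)) = (LINT t|lebesgue. norm (f t))"
      unfolding set_lebesgue_integral_def
      by (intro Bochner_Integration.integral_cong) (use f(2) in \<open>auto simp: indicator_def\<close>)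
    have far: "x \<notin> cube_set I" if "x \<notin> cube_set (dilate 5 I)" for x
      using that side by (simp add: in_cube_set_iff dilate_def)
    have value_eq: "pointwise_value T K \<Phi> f x = (LINT t|lebesgue. f t * K x t)"
      if "x \<notin> cube_set I" for x
      using f that by (intro pointwise_value_eq[OF K assms(1) T \<Phi>])
    show "norm (pointwise_value T K \<Phi> f x) \<le>
               ?C * wgt I x powr (- real CARD('n))
                 * F_K (\<lambda>y. L (1 / 12 * y)) (\<lambda>y. S (inverse (1 / 12) * y)) (\<lambda>y. D (1 / 12 * y))
                     (hull_cube I (point_cube x))
                 * inverse (vol I) * (LINT t:cube_set I|lebesgue. norm (f t))"
      if x: "x \<notin> cube_set (dilate 5 I)" for x
    proof -
      let ?F = "F_K (\<lambda>y. L (1 / 12 * y)) (\<lambda>y. S (inverse (1 / 12) * y)) (\<lambda>y. D (1 / 12 * y))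
                     (hull_cube I (point_cube x))"
      \<comment> \<open>Nonnegativity is what permits enlarging the constant in front of this
        factor.\<close>
      have "0 \<le> ?F"
      proof -
        have "encloses (hull_cube I (point_cube x)) I (point_cube x)"
          using side by (intro hull_cube_encloses) (auto simp: point_cube_def)
        then have Q: "0 \<le> side (hull_cube I (point_cube x))"
          by (simp add: encloses_def)
        then have "0 \<le> rdist (hull_cube I (point_cube x)) unit_cube"
          using hull_cube_encloses[of "hull_cube I (point_cube x)" unit_cube]
          by (simp add: rdist_def encloses_def unit_cube_def)
        with Q show ?thesis
          using adm by (simp add: F_K_def admissible_LSD_def)
      qed
      then have mono: "CK * 2 powr real CARD('n) * wgt I x powr (- real CARD('n)) * ?F * inverse (vol I)
          \<le> ?C * wgt I x powr (- real CARD('n)) * ?F * inverse (vol I)"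
        using CK_le side by (intro mult_right_mono) (auto simp: vol_def)
      have "norm (K x t) \<le> ?C * wgt I x powr (- real CARD('n)) * ?F * inverse (vol I)"
        if t: "t \<in> cube_set I" for t
        using kernel_le_far[where K = K, OF adm CK side x t size] t far[OF x] mono by fastforce
      then show ?thesis
        unfolding value_eq[OF far[OF x]] norm_f
        by (intro kernel_integral_le[OF K assms(1) f far[OF x]])
    qed
    show "norm (pointwise_value T K \<Phi> f x - pointwise_value T K \<Phi> f x') \<le>
               ?C * (infnorm (x - x') powr \<delta> / side I powr \<delta>)
                 * wgt I ((x + x') /\<^sub>R 2) powr (- (real CARD('n) + \<delta>))
                 * L (1 / 12 * side (hull_cube I (point_cube x)))
                 * S (inverse (1 / 12) * infnorm (x - x'))
                 * D (1 / 12 * rdist (hull_cube I (point_cube x)) unit_cube)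
                 * inverse (vol I) * (LINT t:cube_set I|lebesgue. norm (f t))"
      if xx': "infnorm (x - x') < side I / 2 \<and>
             cube_set (hull_cube (point_cube x) (point_cube x')) \<inter> cube_set (dilate 5 I) = {}" for x x'
    proof -
      \<comment> \<open>Both points lie in their hull cube, so its disjointness from
        \<open>5I\<close> places each of them in the far region.\<close>
      have "x \<in> cube_set (point_cube x)" "x' \<in> cube_set (point_cube x')"
        by (simp_all add: in_cube_set_iff point_cube_def infnorm_0)
      moreover have "encloses (hull_cube (point_cube x) (point_cube x')) (point_cube x) (point_cube x')"
        by (intro hull_cube_encloses) (auto simp: point_cube_def)
      ultimately have x: "x \<notin> cube_set (dilate 5 I)" and x': "x' \<notin> cube_set (dilate 5 I)"
        using xx' by (auto simp: encloses_def)
      have "norm (K x t - K x' t) \<le> ?C * (infnorm (x - x') powr \<delta> / side I powr \<delta>)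
                 * wgt I ((x + x') /\<^sub>R 2) powr (- (real CARD('n) + \<delta>))
                 * L (1 / 12 * side (hull_cube I (point_cube x)))
                 * S (inverse (1 / 12) * infnorm (x - x'))
                 * D (1 / 12 * rdist (hull_cube I (point_cube x)) unit_cube)
                 * inverse (vol I)" if t: "t \<in> cube_set I" for t
        \<comment> \<open>Smoothness is applied with the second variable fixed at \<open>t\<close>:
          twice \<open>infnorm (x - x')\<close> is below the side of \<open>I\<close>, hence below
          the distance from \<open>x\<close> to \<open>t\<close>.\<close>
        using xx' far_dist[OF side x t] side smooth[of x x' t t]
        by (intro kernel_diff_le_far[OF adm CK assms(1) side x t]) (simp_all add: infnorm_0)
      then show ?thesis
        unfolding value_eq[OF far[OF x]] value_eq[OF far[OF x']] norm_f
        by (intro kernel_integral_diff_le[OF K assms(1) f far[OF x] far[OF x']])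
    qed
  qed
qed auto

end
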